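(* Let $G$ be a connected, locally path connected topological group, and let $p:\widetilde G\to G$ be a continuous homomorphism of topological groups. Then $(\widetilde G,p)$ is a generalized covering group of $G$ if and only if $p:\widetilde G\to G$ is a rigid covering fibration.
   Context: A continuous map $p:(\widetilde X,\tilde x_0)\to (X,x_0)$ has the unique lifting property if for every connected, locally path connected space $(Y,y_0)$ and every continuous map $f:(Y,y_0)\to (X,x_0)$ with $f_*\pi_1(Y,y_0)\subseteq p_*\pi_1(\widetilde X,\tilde x_0)$ there exists a unique continuous map $\tilde f:(Y,y_0)\to(\widetilde X,\tilde x_0)$ with $p\circ \tilde f=f$. If moreover $\widetilde X$ is connected and locally path connected, then $p$ is called a generalized covering map and $(\widetilde X,p)$ a generalized covering space of $X$. A generalized covering group of a topological group $G$ (with identity $e$) is a pair $(\widetilde G,p)$ consisting of a topological group $\widetilde G$ (with identity $\tilde e$) and a homomorphism $p:(\widetilde G,\tilde e)\to (G,e)$ such that $(\widetilde G,p)$ is a generalized covering space of $G$. A rigid covering fibration is a (Hurewicz) fibration $p:E\to X$, i.e. a map with the homotopy lifting property with respect to all spaces, which has unique path lifting: if $\alpha,\beta$ are paths in $E$ with $p\circ\alpha=p\circ\beta$ and $\alpha(0)=\beta(0)$, then $\alpha=\beta$.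
   Formalization: The formal theorem also assumes that the group G̃ is connected and locally path connected; without this the "if" direction fails, e.g. for the discrete group Z mapping to the trivial group, a rigid covering fibration whose total space is not connected. *)

theory Defs
  imports "HOL-Analysis.Analysis"
begin

text \<open>
  Conventions. A topological group is a type of class \<open>topological_group_add\<close>: the group operation
  is written additively, but it is not assumed to be commutative (nor the topology Hausdorff).

  ``For every space \<open>Y\<close>'' cannot be expressed inside a HOL formula, since it would quantify over
  types. The two properties below that need it therefore take an argument \<open>U :: 'u itself\<close> and
  quantify over all topologies on the type \<open>'u\<close>; note that \<open>topspace Y\<close> may be any subset of \<open>'u\<close>.
\<close>

definition loops :: "'a topology \<Rightarrow> 'a \<Rightarrow> (real \<Rightarrow> 'a) set" where
  "loops X x = {g. pathin X g \<and> g 0 = x \<and> g 1 = x}"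

definition loop_homotopy :: "'a topology \<Rightarrow> 'a \<Rightarrow> ((real \<Rightarrow> 'a) \<times> (real \<Rightarrow> 'a)) set" where
  "loop_homotopy X x =
    {(g, h). homotopic_with (\<lambda>k. k 0 = x \<and> k 1 = x) (top_of_set {0..1}) X g h}"

text \<open>
  The underlying set of the fundamental group; its multiplication plays no role in the inclusion of
  subgroups that occurs in the lifting criterion. The values of a loop outside \<open>{0..1}\<close> are
  immaterial: loops that agree on \<open>{0..1}\<close> lie in the same class.
\<close>

definition fundamental_group :: "'a topology \<Rightarrow> 'a \<Rightarrow> (real \<Rightarrow> 'a) set set" where
  "fundamental_group X x = loops X x // loop_homotopy X x"

definition induced_map ::
    "'b topology \<Rightarrow> 'b \<Rightarrow> ('a \<Rightarrow> 'b) \<Rightarrow> (real \<Rightarrow> 'a) set \<Rightarrow> (real \<Rightarrow> 'b) set" where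
  "induced_map X x f c = (\<Union>g\<in>c. loop_homotopy X x `` {f \<circ> g})"

text \<open>
  Maps are total functions, so uniqueness of a lift on \<open>topspace Y\<close> is expressed by normalising
  lifts to be \<open>extensional\<close>.
\<close>

definition unique_lifting_property ::
    "'u itself \<Rightarrow> 'e topology \<Rightarrow> 'e \<Rightarrow> 'x topology \<Rightarrow> 'x \<Rightarrow> ('e \<Rightarrow> 'x) \<Rightarrow> bool" where
  "unique_lifting_property U E e X x p \<longleftrightarrow>
     continuous_map E X p \<and> e \<in> topspace E \<and> p e = x \<and>
     (\<forall>(Y :: 'u topology) y f.
        connected_space Y \<and> locally_path_connected_space Y \<and> y \<in> topspace Y \<and>
        continuous_map Y X f \<and> f y = x \<and>
        induced_map X x f ` fundamental_group Y y \<subseteq> induced_map X x p ` fundamental_group E e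
        \<longrightarrow> (\<exists>!f'. f' \<in> extensional (topspace Y) \<and> continuous_map Y E f' \<and> f' y = e \<and>
                   (\<forall>z\<in>topspace Y. p (f' z) = f z)))"

definition generalized_covering_map ::
    "'u itself \<Rightarrow> 'e topology \<Rightarrow> 'e \<Rightarrow> 'x topology \<Rightarrow> 'x \<Rightarrow> ('e \<Rightarrow> 'x) \<Rightarrow> bool" where
  "generalized_covering_map U E e X x p \<longleftrightarrow>
     unique_lifting_property U E e X x p \<and>
     connected_space E \<and> locally_path_connected_space E"

definition generalized_covering_group ::
    "'u itself \<Rightarrow> ('h::topological_group_add \<Rightarrow> 'g::topological_group_add) \<Rightarrow> bool" where
  "generalized_covering_group U p \<longleftrightarrow>
     (\<forall>a b. p (a + b) = p a + p b) \<and>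
     generalized_covering_map U (euclidean :: 'h topology) 0 (euclidean :: 'g topology) 0 p"

definition hurewicz_fibration ::
    "'u itself \<Rightarrow> 'e topology \<Rightarrow> 'x topology \<Rightarrow> ('e \<Rightarrow> 'x) \<Rightarrow> bool" where
  "hurewicz_fibration U E X p \<longleftrightarrow>
     continuous_map E X p \<and>
     (\<forall>(Y :: 'u topology) H f.
        continuous_map (prod_topology (top_of_set {0..1::real}) Y) X H \<and>
        continuous_map Y E f \<and> (\<forall>y\<in>topspace Y. p (f y) = H (0, y))
        \<longrightarrow> (\<exists>H'. continuous_map (prod_topology (top_of_set {0..1::real}) Y) E H' \<and>
                  (\<forall>y\<in>topspace Y. H' (0, y) = f y) \<and>
                  (\<forall>t\<in>{0..1}. \<forall>y\<in>topspace Y. p (H' (t, y)) = H (t, y))))"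

definition unique_path_lifting :: "'e topology \<Rightarrow> ('e \<Rightarrow> 'x) \<Rightarrow> bool" where
  "unique_path_lifting E p \<longleftrightarrow>
     (\<forall>\<alpha> \<beta>. pathin E \<alpha> \<and> pathin E \<beta> \<and> (\<forall>t\<in>{0..1}. p (\<alpha> t) = p (\<beta> t)) \<and> \<alpha> 0 = \<beta> 0
        \<longrightarrow> (\<forall>t\<in>{0..1}. \<alpha> t = \<beta> t))"

text \<open>
  Unlike for generalized covering maps, the total space is not required to be connected or locally
  path connected here: a discrete group mapping to the trivial group is a rigid covering fibration.
  A comparison of the two notions therefore has to assume these properties of the total space.
\<close>

definition rigid_covering_fibration ::
    "'u itself \<Rightarrow> 'e topology \<Rightarrow> 'x topology \<Rightarrow> ('e \<Rightarrow> 'x) \<Rightarrow> bool" where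
  "rigid_covering_fibration U E X p \<longleftrightarrow> hurewicz_fibration U E X p \<and> unique_path_lifting E p"

text \<open>
  Types of test spaces for maps into a space on \<open>'x\<close>: an arbitrary type \<open>'u\<close>, enlarged by a summand
  containing the unit interval and the path spaces of \<open>'x\<close>. The summand is needed because over
  a small type such as \<open>unit\<close> both lifting properties would degenerate. Since \<open>'u\<close> is arbitrary,
  every space is, up to homeomorphism, a topology on such a type.
\<close>

type_synonym ('u, 'x) test_points = "'u + real \<times> (real \<Rightarrow> 'x)"

end

theory Submission
  imports Defs
begin

text \<open>
  The two notions meet in a third one, \<^emph>\<open>small path lifting\<close> (\<open>small_path_lifting\<close>): paths of the
  total group are determined by their projection and their start, every path of \<open>G\<close> that starts at
  \<open>0\<close> lifts to a path that starts at \<open>0\<close>, and for every neighbourhood \<open>V\<close> of \<open>0\<close> upstairs there is a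
  neighbourhood \<open>U\<close> of \<open>0\<close> downstairs such that paths in \<open>U\<close> have lifts in \<open>V\<close>. Because \<open>p\<close> is a
  homomorphism, lifts of pointwise sums are sums of lifts, so this continuity of lifting at the
  constant path propagates by translation to continuity of lifting at every path.

  Small path lifting implies both properties, and for arbitrary test spaces. A homotopy \<open>H\<close> with
  initial lift \<open>f\<close> is lifted by adding to \<open>f y\<close> the lift of the path \<open>t \<mapsto> - H (0, y) + H (t, y)\<close>:
  by compactness of the interval, the paths for \<open>y\<close> near \<open>y\<^sub>0\<close> differ from the one for \<open>y\<^sub>0\<close> by a
  small path, hence the lifts differ by a small path too (\<open>is_hurewicz_fibration\<close>). A map \<open>f\<close> on a
  connected, locally path connected space is lifted along paths from the base point; homotopy
  lifting over a square and the condition on fundamental groups make the end point independent of the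
  path, and small path lifting makes it continuous (\<open>has_unique_lifting_property\<close>).

  Conversely, both properties yield small path lifting by means of the same test space: the \<open>fan\<close>
  of all paths of \<open>G\<close> starting at \<open>0\<close>. It is a cone in which the path \<open>\<alpha>\<close> contributes a copy of the
  unit interval, all copies are glued at \<open>0\<close>, and every neighbourhood of the apex contains the whole
  interval of each sufficiently small path. Small path lifting says, up to unique path lifting,
  that the evaluation map, sending the point \<open>t\<close> of the interval of \<open>\<alpha>\<close> to \<open>\<alpha> t\<close>, lifts continuously
  (\<open>small_path_lifting_of_fan_lift\<close>). The fan is connected, locally path connected and contracts to
  its apex. Hence the lifting criterion applies to the evaluation map without any obstruction from
  fundamental groups; and for a fibration the contraction turns the evaluation map into a
  homotopy that starts at the constant map \<open>0\<close>, which lifts. For generalized coverings, unique path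
  lifting is the uniqueness of lifts on a second fan, whose neighbourhoods of the apex need not
  contain any whole interval (\<open>unique_path_lifting_of_generalized_covering_group\<close>).
\<close>

section \<open>Cones on families of intervals\<close>

text \<open>
  The point at height \<open>t\<close> on the spoke \<open>i\<close>. The value lies in a sum type because the test spaces of the
  two lifting properties do. All points of height \<open>0\<close> are represented by one and the same value, which
  is how the spokes are glued.
\<close>

definition fan_point :: "real \<Rightarrow> 'i \<Rightarrow> 'u + real \<times> 'i" where
  "fan_point t i = Inr (if t = 0 then (0, undefined) else (t, i))"

definition fan_apex :: "'u + real \<times> 'i" where
  "fan_apex = Inr (0, undefined)"

definition fan_scale :: "real \<Rightarrow> 'u + real \<times> 'i \<Rightarrow> 'u + real \<times> 'i" where
  "fan_scale s z = (case z of Inl u \<Rightarrow> Inl u | Inr (t, i) \<Rightarrow> fan_point (s * t) i)"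

text \<open>
  The fan over a filter \<open>F\<close> on the set of spokes: away from the apex it carries the topology of the
  disjoint union of the spokes, and a neighbourhood of the apex must contain \<open>F\<close>-almost all spokes
  entirely. For \<open>F = bot\<close> the last condition is void and the fan is the cone with the quotient
  topology.
\<close>

definition fan :: "'i filter \<Rightarrow> ('u + real \<times> 'i) topology" where
  "fan F = topology (\<lambda>W. W \<subseteq> {fan_point t i | t i. t \<in> {0..1}} \<and>
     (\<forall>i. openin (top_of_set {0..1}) {t \<in> {0..1}. fan_point t i \<in> W}) \<and>
     (fan_apex \<in> W \<longrightarrow> (\<forall>\<^sub>F i in F. \<forall>t\<in>{0..1}. fan_point t i \<in> W)))"

lemma fan_point_0 [simp]: "fan_point 0 i = fan_apex"
  by (simp add: fan_point_def fan_apex_def)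

lemma fan_point_eq_iff:
  "fan_point t i = fan_point s j \<longleftrightarrow> t = s \<and> (t = 0 \<or> i = j)"
  by (auto simp: fan_point_def)

lemma fan_point_eq_apex_iff [simp]:
  "fan_point t i = fan_apex \<longleftrightarrow> t = 0" "fan_apex = fan_point t i \<longleftrightarrow> t = 0"
  by (auto simp: fan_point_def fan_apex_def)

lemma fan_scale_point [simp]: "fan_scale s (fan_point t i) = fan_point (s * t) i"
  by (auto simp: fan_scale_def fan_point_def)

lemma fan_scale_apex [simp]: "fan_scale s fan_apex = fan_apex"
  using fan_scale_point[of s 0] by simp

lemma openin_fan:
  "openin (fan F) W \<longleftrightarrow> W \<subseteq> {fan_point t i | t i. t \<in> {0..1}} \<and>
     (\<forall>i. openin (top_of_set {0..1}) {t \<in> {0..1}. fan_point t i \<in> W}) \<and>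
     (fan_apex \<in> W \<longrightarrow> (\<forall>\<^sub>F i in F. \<forall>t\<in>{0..1}. fan_point t i \<in> W))"
  (is "_ \<longleftrightarrow> ?P W")
proof -
  have "istopology ?P"
    unfolding istopology_def
  proof (intro conjI allI impI)
    fix S T assume S: "?P S" and T: "?P T"
    then show "S \<inter> T \<subseteq> {fan_point t i | t i. t \<in> {0..1}}" by blast
    show "openin (top_of_set {0..1}) {t \<in> {0..1}. fan_point t i \<in> S \<inter> T}" for i
    proof -
      have "{t \<in> {0..1}. fan_point t i \<in> S \<inter> T} =
          {t \<in> {0..1}. fan_point t i \<in> S} \<inter> {t \<in> {0..1}. fan_point t i \<in> T}" by blast
      then show ?thesis using S T by (simp add: openin_Int)
    qed
    assume "fan_apex \<in> S \<inter> T"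
    then show "\<forall>\<^sub>F i in F. \<forall>t\<in>{0..1}. fan_point t i \<in> S \<inter> T"
      using S T by (simp add: eventually_conj ball_conj_distrib)
  next
    fix K assume K: "\<forall>W\<in>K. ?P W"
    then show "\<Union>K \<subseteq> {fan_point t i | t i. t \<in> {0..1}}" by blast
    show "openin (top_of_set {0..1}) {t \<in> {0..1}. fan_point t i \<in> \<Union>K}" for i
    proof -
      have "{t \<in> {0..1}. fan_point t i \<in> \<Union>K} = (\<Union>W\<in>K. {t \<in> {0..1}. fan_point t i \<in> W})"
        by blast
      then show ?thesis using K by (auto intro!: openin_Union)
    qed
    assume "fan_apex \<in> \<Union>K"
    then obtain W where "W \<in> K" "fan_apex \<in> W" by blast
    with K have "\<forall>\<^sub>F i in F. \<forall>t\<in>{0..1}. fan_point t i \<in> W" by blast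
    then show "\<forall>\<^sub>F i in F. \<forall>t\<in>{0..1}. fan_point t i \<in> \<Union>K"
      by (rule eventually_mono) (use \<open>W \<in> K\<close> in blast)
  qed
  then show ?thesis by (simp only: fan_def topology_inverse')
qed

lemma topspace_fan: "topspace (fan F) = {fan_point t i | t i. t \<in> {0..1}}"
proof -
  let ?T = "{fan_point t i | t i. t \<in> {0..1}} :: ('a + real \<times> 'b) set"
  have "{t \<in> {0..1}. fan_point t i \<in> ?T} = {0..1}" for i by blast
  then have "openin (fan F) ?T"
    by (auto simp: openin_fan intro!: always_eventually)
  then show ?thesis
    using openin_subset openin_fan[of F "topspace (fan F)"] by blast
qed

lemma fan_point_in_topspace [simp]: "t \<in> {0..1} \<Longrightarrow> fan_point t i \<in> topspace (fan F)"
  by (auto simp: topspace_fan)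

lemma fan_apex_in_topspace [simp]: "fan_apex \<in> topspace (fan F)"
  using fan_point_in_topspace[of 0] by simp

lemma topspace_fanE:
  assumes "z \<in> topspace (fan F)"
  obtains t i where "t \<in> {0..1}" "z = fan_point t i"
  using assms by (auto simp: topspace_fan)

lemma pathin_fan_point: "pathin (fan F) (\<lambda>t. fan_point t i)"
  by (auto simp: pathin_def continuous_map_def openin_fan)

text \<open>
  Continuity at the apex is a statement about uniform convergence along the filter: this and its
  converse \<open>eventually_fan_spoke\<close> translate between maps on the fan and families of paths.
\<close>

lemma continuous_map_fanI:
  assumes "\<And>i. pathin X (\<lambda>t. g (fan_point t i))"
    and "\<And>W. openin X W \<Longrightarrow> g fan_apex \<in> W \<Longrightarrow> \<forall>\<^sub>F i in F. \<forall>t\<in>{0..1}. g (fan_point t i) \<in> W"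
  shows "continuous_map (fan F) X g"
  unfolding continuous_map_def
proof (intro conjI allI impI)
  show "g \<in> topspace (fan F) \<rightarrow> topspace X"
    using assms(1) by (fastforce simp: topspace_fan dest: path_image_subset_topspace)
  fix W assume W: "openin X W"
  have *: "{t \<in> {0..1}. fan_point t i \<in> {z \<in> topspace (fan F). g z \<in> W}}
      = {t \<in> topspace (top_of_set {0..1}). g (fan_point t i) \<in> W}" for i
    by auto
  show "openin (fan F) {z \<in> topspace (fan F). g z \<in> W}"
    unfolding openin_fan *
  proof (intro conjI allI impI)
    show "openin (top_of_set {0..1}) {t \<in> topspace (top_of_set {0..1}). g (fan_point t i) \<in> W}" for i
      using assms(1)[of i] W unfolding pathin_def by (rule openin_continuous_map_preimage)
    assume "fan_apex \<in> {z \<in> topspace (fan F). g z \<in> W}"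
    with assms(2)[OF W] have "\<forall>\<^sub>F i in F. \<forall>t\<in>{0..1}. g (fan_point t i) \<in> W" by simp
    then show "\<forall>\<^sub>F i in F. \<forall>t\<in>{0..1}. fan_point t i \<in> {z \<in> topspace (fan F). g z \<in> W}"
      by (rule eventually_mono) simp
  qed (auto simp: topspace_fan)
qed

lemma eventually_fan_spoke:
  assumes "continuous_map (fan F) X g" "openin X W" "g fan_apex \<in> W"
  shows "\<forall>\<^sub>F i in F. \<forall>t\<in>{0..1}. g (fan_point t i) \<in> W"
proof -
  have "openin (fan F) {z \<in> topspace (fan F). g z \<in> W}"
    using assms(1,2) by (rule openin_continuous_map_preimage)
  with assms(3) have "\<forall>\<^sub>F i in F. \<forall>t\<in>{0..1}. fan_point t i \<in> {z \<in> topspace (fan F). g z \<in> W}"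
    unfolding openin_fan by simp
  then show ?thesis by (rule eventually_mono) simp
qed

lemma path_component_of_fan_spoke:
  assumes T: "convex T" "T \<subseteq> {0..1}" "\<And>t. t \<in> T \<Longrightarrow> fan_point t i \<in> W" and "a \<in> T" "b \<in> T"
  shows "path_component_of (subtopology (fan F) W) (fan_point a i) (fan_point b i)"
  unfolding path_component_of_def
proof (intro exI conjI)
  let ?l = "linepath a b"
  have l: "?l t \<in> T" if "t \<in> {0..1}" for t
    using that assms(1,4,5) convex_contains_segment[of T] linepath_in_path[OF that, of a b] by blast
  have "continuous_map (top_of_set {0..1}) (top_of_set {0..1}) ?l"
    using l T(2) by (auto simp: continuous_map_in_subtopology path_def[symmetric])
  then have "pathin (fan F) ((\<lambda>t. fan_point t i) \<circ> ?l)"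
    using pathin_fan_point[of F i] unfolding pathin_def by (rule continuous_map_compose)
  then show "pathin (subtopology (fan F) W) (\<lambda>t. fan_point (?l t) i)"
    using l T(3) by (auto simp: pathin_subtopology o_def)
qed (auto simp: linepath_def)

lemma path_connected_space_fan: "path_connected_space (fan F :: ('u + real \<times> 'i) topology)"
proof -
  have *: "path_component_of (fan F) fan_apex z" if z: "z \<in> topspace (fan F)" for z :: "'u + real \<times> 'i"
  proof -
    obtain t i where ti: "t \<in> {0..1}" "z = fan_point t i" using z by (rule topspace_fanE)
    have "path_component_of (subtopology (fan F) (topspace (fan F))) (fan_point 0 i) (fan_point t i)"
      by (rule path_component_of_fan_spoke[where T = "{0..1}"]) (use ti in auto)
    then show ?thesis using ti by simp
  qed
  show ?thesis
    unfolding path_connected_space_iff_path_component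
  proof (intro ballI)
    fix z w :: "'u + real \<times> 'i" assume "z \<in> topspace (fan F)" "w \<in> topspace (fan F)"
    then show "path_component_of (fan F) z w"
      by (rule path_component_of_trans[OF path_component_of_sym[OF *] *])
  qed
qed

text \<open>
  A path component of an open set is open on each spoke, because intervals are locally path connected,
  and it absorbs every spoke contained in the open set as soon as it contains the apex.
\<close>

lemma locally_path_connected_space_fan: "locally_path_connected_space (fan F)"
  unfolding locally_path_connected_space_eq_open_path_component_of
proof (intro allI impI, elim conjE)
  fix W :: "('a + real \<times> 'b) set" and x assume W: "openin (fan F) W" and "x \<in> W"
  define C where "C = Collect (path_component_of (subtopology (fan F) W) x)"
  have CW: "C \<subseteq> W"
    using path_component_of_subset_topspace[of "subtopology (fan F) W" x] by (auto simp: C_def)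
  have CI: "y \<in> C" if "z \<in> C" "path_component_of (subtopology (fan F) W) z y" for y z
    using that path_component_of_trans unfolding C_def by fast
  have "openin (fan F) C"
    unfolding openin_fan
  proof (intro conjI allI impI)
    show "C \<subseteq> {fan_point t i | t i. t \<in> {0..1}}"
      using CW W by (auto simp: openin_fan)
    show "openin (top_of_set {0..1}) {t \<in> {0..1}. fan_point t i \<in> C}" for i
    proof (subst openin_subopen, intro ballI)
      fix t assume t: "t \<in> {t \<in> {0..1}. fan_point t i \<in> C}"
      have "openin (top_of_set {0..1}) {t \<in> {0..1}. fan_point t i \<in> W}"
        using W by (simp add: openin_fan)
      with t CW obtain e where e: "e > 0" "ball t e \<inter> {0..1} \<subseteq> {t \<in> {0..1}. fan_point t i \<in> W}"
        unfolding openin_contains_ball by blast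
      let ?T = "ball t e \<inter> {0..1}"
      have "path_component_of (subtopology (fan F) W) (fan_point t i) (fan_point s i)" if "s \<in> ?T" for s
        by (rule path_component_of_fan_spoke[where T = ?T]) (use that t e in \<open>auto intro: convex_Int\<close>)
      then have "?T \<subseteq> {t \<in> {0..1}. fan_point t i \<in> C}" using t CI by blast
      moreover have "openin (top_of_set {0..1}) ?T"
        by (subst Int_commute) (rule openin_open_Int, simp)
      ultimately show "\<exists>T. openin (top_of_set {0..1}) T \<and> t \<in> T \<and> T \<subseteq> {t \<in> {0..1}. fan_point t i \<in> C}"
        using t e(1) by (intro exI[of _ ?T]) auto
    qed
    assume apex: "fan_apex \<in> C"
    then have "\<forall>\<^sub>F i in F. \<forall>t\<in>{0..1}. fan_point t i \<in> W" using W CW by (auto simp: openin_fan)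
    then show "\<forall>\<^sub>F i in F. \<forall>t\<in>{0..1}. fan_point t i \<in> C"
    proof (rule eventually_mono, intro ballI)
      fix i t assume i: "\<forall>t\<in>{0..1}. fan_point t i \<in> W" and t: "t \<in> {0..1::real}"
      have "path_component_of (subtopology (fan F) W) (fan_point 0 i) (fan_point t i)"
        by (rule path_component_of_fan_spoke[where T = "{0..1}"]) (use i t in auto)
      then show "fan_point t i \<in> C" using apex CI by simp
    qed
  qed
  then show "openin (fan F) (Collect (path_component_of (subtopology (fan F) W) x))"
    by (simp add: C_def)
qed

lemma openin_unit_interval_product:
  assumes "openin (top_of_set {0..1::real}) S"
  shows "openin (prod_topology (top_of_set {0..1}) (top_of_set {0..1}))
           {(s, t). s \<in> {0..1} \<and> t \<in> {0..1} \<and> s * t \<in> S}"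
proof -
  have "continuous_map (prod_topology (top_of_set {0..1}) (top_of_set {0..1})) (top_of_set {0..1})
          (\<lambda>x. fst x * snd x :: real)"
    unfolding continuous_map_in_subtopology
    by (intro conjI continuous_map_real_mult continuous_map_into_fulltopology[OF continuous_map_fst]
          continuous_map_into_fulltopology[OF continuous_map_snd]) (auto simp: mult_le_one)
  from openin_continuous_map_preimage[OF this assms] show ?thesis
    by (rule back_subst[of "openin _"]) auto
qed

text \<open>
  The star-shaped core of an open set about the apex. It provides the neighbourhoods on which the radial
  contraction can be controlled uniformly in the contraction parameter.
\<close>

lemma openin_fan_star:
  assumes W: "openin (fan F) W"
  shows "openin (fan F) {z \<in> topspace (fan F). \<forall>s\<in>{0..1}. fan_scale s z \<in> W}"
    (is "openin _ ?C")
  unfolding openin_fan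
proof (intro conjI allI impI)
  show "openin (top_of_set {0..1}) {t \<in> {0..1}. fan_point t i \<in> ?C}" for i
  proof (subst openin_subopen, intro ballI)
    fix t assume t: "t \<in> {t \<in> {0..1}. fan_point t i \<in> ?C}"
    have "openin (top_of_set {0..1}) {t \<in> {0..1}. fan_point t i \<in> W}"
      using W by (simp add: openin_fan)
    note open_prod = openin_unit_interval_product[OF this]
    have compact: "compactin (top_of_set {0..1}) {0..1::real}" by (simp add: compactin_subtopology)
    have t01: "t \<in> {0..1}" and tW: "fan_point (s * t) i \<in> W" if "s \<in> {0..1}" for s
      using t that by auto
    then have t': "t \<in> topspace (top_of_set {0..1})" by force
    have sub: "{0..1} \<times> {t} \<subseteq> {(s, t). s \<in> {0..1} \<and> t \<in> {0..1} \<and> s * t \<in> {t \<in> {0..1}. fan_point t i \<in> W}}"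
      using t01 tW by (simp add: subset_iff mult_le_one)
    obtain U V where "openin (top_of_set {0..1}) U" and V: "openin (top_of_set {0..1}) V"
      and U: "{0..1} \<subseteq> U" and tV: "t \<in> V"
      and UV: "U \<times> V \<subseteq> {(s, t). s \<in> {0..1} \<and> t \<in> {0..1} \<and> s * t \<in> {t \<in> {0..1}. fan_point t i \<in> W}}"
      using tube_lemma_left[OF open_prod compact t' sub] by (elim exE conjE) (rule that)
    have "V \<subseteq> {t \<in> {0..1}. fan_point t i \<in> ?C}"
    proof
      fix r assume r: "r \<in> V"
      have "r \<in> {0..1} \<and> fan_point (s * r) i \<in> W" if "s \<in> {0..1}" for s
        using subsetD[OF UV, of "(s, r)"] subsetD[OF U that] r by simp
      then show "r \<in> {t \<in> {0..1}. fan_point t i \<in> ?C}" by force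
    qed
    with V tV show "\<exists>T. openin (top_of_set {0..1}) T \<and> t \<in> T \<and> T \<subseteq> {t \<in> {0..1}. fan_point t i \<in> ?C}"
      by blast
  qed
  assume "fan_apex \<in> ?C"
  then have "fan_apex \<in> W" by force
  then have "\<forall>\<^sub>F i in F. \<forall>t\<in>{0..1}. fan_point t i \<in> W" using W by (simp add: openin_fan)
  then show "\<forall>\<^sub>F i in F. \<forall>t\<in>{0..1}. fan_point t i \<in> ?C"
    by (rule eventually_mono) (simp add: mult_le_one)
qed (auto simp: topspace_fan)

lemma openin_fan_spoke:
  fixes F :: "'i filter"
  assumes "openin (top_of_set {0..1}) B" "0 \<notin> B"
  shows "openin (fan F) ((\<lambda>t. fan_point t i :: 'u + real \<times> 'i) ` B)"
proof -
  note B = openin_imp_subset[OF assms(1)]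
  have slice: "{t \<in> {0..1}. fan_point t j \<in> (\<lambda>t. fan_point t i) ` B} = (if j = i then B else {})" for j
    using assms(2) B by (auto simp: fan_point_eq_iff)
  have "(fan_apex :: 'u + real \<times> 'i) \<notin> (\<lambda>t. fan_point t i) ` B" using assms(2) by auto
  moreover have "(\<lambda>t. fan_point t i :: 'u + real \<times> 'i) ` B \<subseteq> {fan_point t i | t i. t \<in> {0..1}}"
    using B by blast
  ultimately show ?thesis
    unfolding openin_fan slice using assms(1) by simp
qed

text \<open>
  The radial contraction is jointly continuous. Near the apex, the star-shaped core of the target
  neighbourhood works for all parameters; at any other point the spoke without the apex is open, and
  the contraction multiplies the heights on it.
\<close>

lemma continuous_map_fan_scale:
  fixes F :: "'i filter"
  shows "continuous_map (prod_topology (top_of_set {0..1}) (fan F)) (fan F)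
           (\<lambda>(s, z :: 'u + real \<times> 'i). fan_scale s z)"
  unfolding continuous_map_def
proof (intro conjI allI impI)
  show "(\<lambda>(s, z :: 'u + real \<times> 'i). fan_scale s z) \<in> topspace (prod_topology (top_of_set {0..1}) (fan F)) \<rightarrow> topspace (fan F)"
  proof (rule Pi_I)
    fix x :: "real \<times> ('u + real \<times> 'i)"
    assume x: "x \<in> topspace (prod_topology (top_of_set {0..1}) (fan F))"
    then obtain s z where xs: "x = (s, z)" and s: "s \<in> {0..1}" and "z \<in> topspace (fan F)"
      by (cases x) simp
    from this(3) obtain t i where "t \<in> {0..1}" "z = fan_point t i" by (rule topspace_fanE)
    then show "(case x of (s, z) \<Rightarrow> fan_scale s z) \<in> topspace (fan F)"
      using xs s by (simp add: mult_le_one)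
  qed
  fix W :: "('u + real \<times> 'i) set" assume W: "openin (fan F) W"
  let ?P = "{x \<in> topspace (prod_topology (top_of_set {0..1}) (fan F)). (case x of (s, z) \<Rightarrow> fan_scale s z) \<in> W}"
  show "openin (prod_topology (top_of_set {0..1}) (fan F)) ?P"
    unfolding openin_prod_topology_alt
  proof (intro allI impI)
    fix s z assume "(s, z) \<in> ?P"
    then have s: "s \<in> {0..1}" and z: "z \<in> topspace (fan F)" and sz: "fan_scale s z \<in> W" by auto
    obtain t i where t: "t \<in> {0..1}" and zt: "z = fan_point t i" using z by (rule topspace_fanE)
    show "\<exists>U V. openin (top_of_set {0..1}) U \<and> openin (fan F) V \<and> s \<in> U \<and> z \<in> V \<and> U \<times> V \<subseteq> ?P"
    proof (cases "t = 0")
      case True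
      let ?C = "{z \<in> topspace (fan F). \<forall>s\<in>{0..1}. fan_scale s z \<in> W}"
      have "z \<in> ?C" using True zt sz by simp
      moreover have "{0..1} \<times> ?C \<subseteq> ?P" by auto
      moreover have "openin (top_of_set {0..1}) {0..1::real}" by simp
      ultimately show ?thesis
        using openin_fan_star[OF W] s by (intro exI conjI)
    next
      case False
      have "openin (top_of_set {0..1}) {t \<in> {0..1}. fan_point t i \<in> W}"
        using W by (simp add: openin_fan)
      note open_prod = openin_unit_interval_product[OF this]
      have "(s, t) \<in> {(s, t). s \<in> {0..1} \<and> t \<in> {0..1} \<and> s * t \<in> {t \<in> {0..1}. fan_point t i \<in> W}}"
        using s t sz zt by (simp add: mult_le_one)
      from open_prod[unfolded openin_prod_topology_alt, rule_format, OF this]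
      obtain A B where A: "openin (top_of_set {0..1}) A" "s \<in> A"
        and B: "openin (top_of_set {0..1}) B" "t \<in> B"
        and AB: "A \<times> B \<subseteq> {(s, t). s \<in> {0..1} \<and> t \<in> {0..1} \<and> s * t \<in> {t \<in> {0..1}. fan_point t i \<in> W}}"
        by (elim exE conjE) (rule that)
      have "openin (top_of_set {0..1}) (B - {0})"
        using B(1) by (metis open_delete Diff_Int2 Int_Diff openin_open)
      then have "openin (fan F) ((\<lambda>t. fan_point t i) ` (B - {0}))"
        by (rule openin_fan_spoke) simp
      moreover have "z \<in> (\<lambda>t. fan_point t i) ` (B - {0})" using B False zt by auto
      moreover have "A \<times> (\<lambda>t. fan_point t i) ` (B - {0}) \<subseteq> ?P"
      proof
        fix x :: "real \<times> ('u + real \<times> 'i)"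
        assume "x \<in> A \<times> (\<lambda>t. fan_point t i) ` (B - {0})"
        then obtain r u where x: "x = (r, fan_point u i)" and "(r, u) \<in> A \<times> B" by blast
        with AB have "(r, u) \<in> {(s, t). s \<in> {0..1} \<and> t \<in> {0..1} \<and> s * t \<in> {t \<in> {0..1}. fan_point t i \<in> W}}"
          by blast
        then show "x \<in> ?P" unfolding x by simp
      qed
      ultimately show ?thesis using A by (intro exI conjI)
    qed
  qed
qed

section \<open>The inclusion of fundamental groups in terms of loops\<close>

lemma loop_homotopyI:
  fixes h :: "real \<times> real \<Rightarrow> 'a"
  assumes "continuous_map (prod_topology (top_of_set {0..1}) (top_of_set {0..1})) X h"
    and "\<And>t. t \<in> {0..1} \<Longrightarrow> h (0, t) = a t" "\<And>t. t \<in> {0..1} \<Longrightarrow> h (1, t) = b t"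
    and "\<And>s. s \<in> {0..1} \<Longrightarrow> h (s, 0) = x" "\<And>s. s \<in> {0..1} \<Longrightarrow> h (s, 1) = x"
  shows "(a, b) \<in> loop_homotopy X x"
proof -
  have "homotopic_with (\<lambda>k. k 0 = x \<and> k 1 = x) (top_of_set {0..1}) X a b"
    using assms by (subst homotopic_with) (auto intro!: exI[of _ h])
  then show ?thesis by (simp add: loop_homotopy_def)
qed

lemma loop_homotopy_sym: "(a, b) \<in> loop_homotopy X x \<Longrightarrow> (b, a) \<in> loop_homotopy X x"
  by (auto simp: loop_homotopy_def intro: homotopic_with_symD)

lemma loop_homotopy_trans:
  "(a, b) \<in> loop_homotopy X x \<Longrightarrow> (b, c) \<in> loop_homotopy X x \<Longrightarrow> (a, c) \<in> loop_homotopy X x"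
  by (auto simp: loop_homotopy_def intro: homotopic_with_trans)

lemma loop_homotopy_refl: "a \<in> loops X x \<Longrightarrow> (a, a) \<in> loop_homotopy X x"
  by (auto simp: loop_homotopy_def loops_def pathin_def)

lemma loop_homotopy_class_eq_iff:
  assumes "a \<in> loops X x"
  shows "loop_homotopy X x `` {a} = loop_homotopy X x `` {b} \<longleftrightarrow> (a, b) \<in> loop_homotopy X x"
proof
  assume "loop_homotopy X x `` {a} = loop_homotopy X x `` {b}"
  moreover have "a \<in> loop_homotopy X x `` {a}" using loop_homotopy_refl[OF assms] by simp
  ultimately have "(b, a) \<in> loop_homotopy X x" by blast
  then show "(a, b) \<in> loop_homotopy X x" by (rule loop_homotopy_sym)
next
  assume ab: "(a, b) \<in> loop_homotopy X x"
  have "(b, c) \<in> loop_homotopy X x" if "(a, c) \<in> loop_homotopy X x" for c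
    using loop_homotopy_trans[OF loop_homotopy_sym[OF ab] that] .
  moreover have "(a, c) \<in> loop_homotopy X x" if "(b, c) \<in> loop_homotopy X x" for c
    using loop_homotopy_trans[OF ab that] .
  ultimately show "loop_homotopy X x `` {a} = loop_homotopy X x `` {b}" by blast
qed

lemma loop_homotopy_compose:
  assumes "(a, b) \<in> loop_homotopy X x" "continuous_map X Z f"
  shows "(f \<circ> a, f \<circ> b) \<in> loop_homotopy Z (f x)"
  using assms by (auto simp: loop_homotopy_def intro: homotopic_with_compose_continuous_map_left)

lemma loops_compose: "a \<in> loops X x \<Longrightarrow> continuous_map X Z f \<Longrightarrow> f \<circ> a \<in> loops Z (f x)"
  by (auto simp: loops_def intro: pathin_compose)

lemma induced_map_class:
  assumes "continuous_map X Z f" "a \<in> loops X x"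
  shows "induced_map Z (f x) f (loop_homotopy X x `` {a}) = loop_homotopy Z (f x) `` {f \<circ> a}"
proof -
  have "loop_homotopy Z (f x) `` {f \<circ> b} = loop_homotopy Z (f x) `` {f \<circ> a}"
    if "(a, b) \<in> loop_homotopy X x" for b
    using loop_homotopy_class_eq_iff[OF loops_compose[OF assms(2,1)], of "f \<circ> b"]
      loop_homotopy_compose[OF that assms(1)] by simp
  then show ?thesis
    using loop_homotopy_refl[OF assms(2)] unfolding induced_map_def by blast
qed

text \<open>
  The inclusion of images of fundamental groups, freed from homotopy classes: this is the form in
  which the hypothesis of the lifting criterion is verified and used.
\<close>

lemma induced_image_subset_iff:
  assumes f: "continuous_map Y X f" "f y = x" and p: "continuous_map E X p" "p e = x"
  shows "induced_map X x f ` fundamental_group Y y \<subseteq> induced_map X x p ` fundamental_group E e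
     \<longleftrightarrow> (\<forall>a\<in>loops Y y. \<exists>b\<in>loops E e. (f \<circ> a, p \<circ> b) \<in> loop_homotopy X x)"
proof -
  have 1: "induced_map X x f ` fundamental_group Y y = (\<lambda>a. loop_homotopy X x `` {f \<circ> a}) ` loops Y y"
    using induced_map_class[OF f(1), of _ y] f(2) unfolding fundamental_group_def quotient_def
    by auto
  have 2: "induced_map X x p ` fundamental_group E e = (\<lambda>b. loop_homotopy X x `` {p \<circ> b}) ` loops E e"
    using induced_map_class[OF p(1), of _ e] p(2) unfolding fundamental_group_def quotient_def
    by auto
  have "loop_homotopy X x `` {f \<circ> a} = loop_homotopy X x `` {p \<circ> b} \<longleftrightarrow> (f \<circ> a, p \<circ> b) \<in> loop_homotopy X x"
    if "a \<in> loops Y y" for a b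
    using loop_homotopy_class_eq_iff[OF loops_compose[OF that f(1)]] f(2) by simp
  then show ?thesis unfolding 1 2 by (fastforce simp: image_subset_iff image_iff)
qed

lemma const_in_loops: "x \<in> topspace X \<Longrightarrow> (\<lambda>_. x) \<in> loops X x"
  by (simp add: loops_def)

text \<open>
  Loops at the apex are contracted radially, which keeps their end points at the apex; so every
  pointed map on the fan satisfies the hypothesis of the lifting criterion.
\<close>

lemma loop_homotopy_fan_apex:
  assumes "a \<in> loops (fan F) fan_apex"
  shows "(a, \<lambda>_. fan_apex) \<in> loop_homotopy (fan F) fan_apex"
proof (rule loop_homotopyI[where h = "\<lambda>(s, t). fan_scale (1 - s) (a t)"])
  let ?I = "top_of_set {0..1::real}"
  have a: "continuous_map ?I (fan F) a" and a01: "a 0 = fan_apex" "a 1 = fan_apex"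
    using assms by (auto simp: loops_def pathin_def)
  have "continuous_map (prod_topology ?I ?I) (prod_topology ?I (fan F)) (\<lambda>x. (1 - fst x, a (snd x)))"
  proof (rule continuous_map_pairedI)
    show "continuous_map (prod_topology ?I ?I) ?I (\<lambda>x. 1 - fst x)"
      unfolding continuous_map_in_subtopology
      by (intro conjI continuous_map_diff continuous_map_into_fulltopology[OF continuous_map_fst])
         auto
    show "continuous_map (prod_topology ?I ?I) (fan F) (\<lambda>x. a (snd x))"
      using continuous_map_compose[OF continuous_map_snd a] unfolding o_def .
  qed
  from continuous_map_compose[OF this continuous_map_fan_scale]
  show "continuous_map (prod_topology ?I ?I) (fan F) (\<lambda>(s, t). fan_scale (1 - s) (a t))"
    by (simp add: o_def case_prod_unfold)
  show "(case (0, t) of (s, t) \<Rightarrow> fan_scale (1 - s) (a t)) = a t"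
    "(case (1, t) of (s, t) \<Rightarrow> fan_scale (1 - s) (a t)) = fan_apex" if t: "t \<in> {0..1}" for t
  proof -
    have "a t \<in> topspace (fan F)" using continuous_map_funspace[OF a] t by auto
    then show "(case (0, t) of (s, t) \<Rightarrow> fan_scale (1 - s) (a t)) = a t"
      "(case (1, t) of (s, t) \<Rightarrow> fan_scale (1 - s) (a t)) = fan_apex"
      by (auto elim!: topspace_fanE)
  qed
qed (use assms in \<open>auto simp: loops_def\<close>)

lemma unique_lift_of_fan:
  fixes f :: "'u + real \<times> 'i \<Rightarrow> 'x"
  assumes ulp: "unique_lifting_property TYPE('u + real \<times> 'i) E e X x p"
    and f: "continuous_map (fan F) X f" "f fan_apex = x"
  shows "\<exists>!f'. f' \<in> extensional (topspace (fan F)) \<and> continuous_map (fan F) E f' \<and>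
    f' fan_apex = e \<and> (\<forall>z\<in>topspace (fan F). p (f' z) = f z)"
proof -
  have p: "continuous_map E X p" "e \<in> topspace E" "p e = x"
    using ulp by (auto simp: unique_lifting_property_def)
  have "\<exists>b\<in>loops E e. (f \<circ> a, p \<circ> b) \<in> loop_homotopy X x" if "a \<in> loops (fan F) fan_apex" for a
    using loop_homotopy_compose[OF loop_homotopy_fan_apex[OF that] f(1)] const_in_loops[OF p(2)] p(3) f(2)
    by (intro bexI[of _ "\<lambda>_. e"]) (simp_all add: o_def)
  then have "induced_map X x f ` fundamental_group (fan F) fan_apex \<subseteq> induced_map X x p ` fundamental_group E e"
    by (subst induced_image_subset_iff[OF f p(1,3)]) blast
  moreover have "connected_space (fan F :: ('u + real \<times> 'i) topology)"
    by (rule path_connected_imp_connected_space[OF path_connected_space_fan])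
  moreover have "\<forall>(Y :: ('u + real \<times> 'i) topology) y f.
        connected_space Y \<and> locally_path_connected_space Y \<and> y \<in> topspace Y \<and>
        continuous_map Y X f \<and> f y = x \<and>
        induced_map X x f ` fundamental_group Y y \<subseteq> induced_map X x p ` fundamental_group E e
        \<longrightarrow> (\<exists>!f'. f' \<in> extensional (topspace Y) \<and> continuous_map Y E f' \<and> f' y = e \<and>
                   (\<forall>z\<in>topspace Y. p (f' z) = f z))"
    using ulp unfolding unique_lifting_property_def by (elim conjE)
  ultimately show ?thesis
    using f locally_path_connected_space_fan fan_apex_in_topspace
    by (elim allE[of _ "fan F"] allE[of _ fan_apex] allE[of _ f]) (rule mp, assumption, simp)
qed

section \<open>Small path lifting\<close>

definition based_path :: "(real \<Rightarrow> 'a::{topological_space, zero}) \<Rightarrow> bool" where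
  "based_path \<alpha> \<longleftrightarrow> path \<alpha> \<and> \<alpha> 0 = 0"

lemma pathin_euclidean_iff_path: "pathin euclidean \<alpha> \<longleftrightarrow> path \<alpha>"
  by (simp add: pathin_def path_def)

lemma continuous_map_group_add:
  fixes f g :: "'a \<Rightarrow> 'b::topological_group_add"
  assumes "continuous_map X euclidean f" "continuous_map X euclidean g"
  shows "continuous_map X euclidean (\<lambda>x. f x + g x)"
  using assms by (auto simp: continuous_map_atin intro: tendsto_add)

lemma continuous_map_group_minus:
  fixes f :: "'a \<Rightarrow> 'b::topological_group_add"
  assumes "continuous_map X euclidean f"
  shows "continuous_map X euclidean (\<lambda>x. - f x)"
  using assms by (auto simp: continuous_map_atin intro: tendsto_minus)

lemma path_group_add:
  fixes a b :: "real \<Rightarrow> 'b::topological_group_add"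
  shows "path a \<Longrightarrow> path b \<Longrightarrow> path (\<lambda>t. a t + b t)"
  unfolding path_def by (rule continuous_on_add)

lemma path_group_minus:
  fixes a :: "real \<Rightarrow> 'b::topological_group_add"
  shows "path a \<Longrightarrow> path (\<lambda>t. - a t)"
  unfolding path_def by (rule continuous_on_minus)

lemma path_const_add:
  fixes a :: "real \<Rightarrow> 'b::topological_group_add"
  shows "path a \<Longrightarrow> path (\<lambda>t. c + a t)"
  by (rule path_group_add) (simp_all add: path_def)

lemma open_add_nhd:
  fixes V :: "'b::topological_group_add set"
  assumes "open V" "c + d \<in> V"
  obtains A B where "open A" "open B" "c \<in> A" "d \<in> B" "\<And>a b. a \<in> A \<Longrightarrow> b \<in> B \<Longrightarrow> a + b \<in> V"
proof -
  have "((\<lambda>x. fst x + snd x) \<longlongrightarrow> c + d) (nhds c \<times>\<^sub>F nhds d)" by (rule tendsto_add_Pair)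
  then have "eventually (\<lambda>x. fst x + snd x \<in> V) (nhds c \<times>\<^sub>F nhds d)"
    using assms by (rule topological_tendstoD)
  then obtain P Q where "eventually P (nhds c)" "eventually Q (nhds d)"
    and PQ: "\<And>x y. P x \<Longrightarrow> Q y \<Longrightarrow> x + y \<in> V"
    unfolding eventually_prod_filter by auto
  then show ?thesis using that unfolding eventually_nhds by metis
qed

text \<open>
  Concatenation of paths without a topology on the type, so that it also serves paths in test
  spaces.
\<close>

definition path_concat :: "(real \<Rightarrow> 'a) \<Rightarrow> (real \<Rightarrow> 'a) \<Rightarrow> real \<Rightarrow> 'a" where
  "path_concat a b = (\<lambda>t. if t \<le> 1/2 then a (2 * t) else b (2 * t - 1))"

lemma path_concat_0 [simp]: "path_concat a b 0 = a 0"
  and path_concat_1 [simp]: "path_concat a b 1 = b 1"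
  by (simp_all add: path_concat_def)

lemma comp_path_concat: "f \<circ> path_concat a b = path_concat (f \<circ> a) (f \<circ> b)"
  by (auto simp: path_concat_def)

lemma pathin_path_concat:
  assumes a: "pathin X a" and b: "pathin X b" and ab: "a 1 = b 0"
  shows "pathin X (path_concat a b)"
  unfolding pathin_def path_concat_def
proof (rule continuous_map_cases_le)
  let ?I = "top_of_set {0..1::real}"
  show "continuous_map ?I euclideanreal (\<lambda>x. x)" "continuous_map ?I euclideanreal (\<lambda>x. 1/2)"
    by simp_all
  have "continuous_map (subtopology ?I {x \<in> topspace ?I. x \<le> 1/2}) ?I (\<lambda>x. 2 * x)"
    by (auto simp: continuous_map_in_subtopology subtopology_subtopology intro!: continuous_intros)
  then show "continuous_map (subtopology ?I {x \<in> topspace ?I. x \<le> 1/2}) X (\<lambda>x. a (2 * x))"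
    using continuous_map_compose[OF _ a[unfolded pathin_def]] by (fastforce simp: o_def)
  have "continuous_map (subtopology ?I {x \<in> topspace ?I. 1/2 \<le> x}) ?I (\<lambda>x. 2 * x - 1)"
    by (auto simp: continuous_map_in_subtopology subtopology_subtopology intro!: continuous_intros)
  then show "continuous_map (subtopology ?I {x \<in> topspace ?I. 1/2 \<le> x}) X (\<lambda>x. b (2 * x - 1))"
    using continuous_map_compose[OF _ b[unfolded pathin_def]] by (fastforce simp: o_def)
  show "a (2 * x) = b (2 * x - 1)" if "x \<in> topspace ?I" "x = 1/2" for x
  proof -
    have "2 * x = 1" using that by simp
    then show ?thesis using ab by simp
  qed
qed

lemma pathin_reverse:
  assumes "pathin X a"
  shows "pathin X (\<lambda>t. a (1 - t))"
proof -
  have "continuous_map (top_of_set {0..1}) (top_of_set {0..1}) (\<lambda>t. 1 - t :: real)"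
    by (auto simp: continuous_map_in_subtopology intro!: continuous_intros)
  from continuous_map_compose[OF this assms[unfolded pathin_def]] show ?thesis
    by (simp add: pathin_def o_def)
qed

lemma continuous_map_compose_pair:
  assumes "continuous_map (prod_topology X Y) Z h" "continuous_map W X f" "continuous_map W Y g"
  shows "continuous_map W Z (\<lambda>w. h (f w, g w))"
  using continuous_map_compose[OF continuous_map_pairedI[OF assms(2,3)] assms(1)]
  by (simp add: o_def)

lemma hurewicz_fibrationE:
  fixes Y :: "'u topology"
  assumes "hurewicz_fibration TYPE('u) E X p"
    and "continuous_map (prod_topology (top_of_set {0..1::real}) Y) X H"
    and "continuous_map Y E f" "\<And>y. y \<in> topspace Y \<Longrightarrow> p (f y) = H (0, y)"
  obtains H' where "continuous_map (prod_topology (top_of_set {0..1::real}) Y) E H'"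
    and "\<And>y. y \<in> topspace Y \<Longrightarrow> H' (0, y) = f y"
    and "\<And>t y. t \<in> {0..1} \<Longrightarrow> y \<in> topspace Y \<Longrightarrow> p (H' (t, y)) = H (t, y)"
proof -
  have "\<exists>H'. continuous_map (prod_topology (top_of_set {0..1::real}) Y) E H' \<and>
      (\<forall>y\<in>topspace Y. H' (0, y) = f y) \<and> (\<forall>t\<in>{0..1}. \<forall>y\<in>topspace Y. p (H' (t, y)) = H (t, y))"
    using assms(1)[unfolded hurewicz_fibration_def, THEN conjunct2, rule_format, of Y H f] assms(2-4)
    by simp
  then show thesis using that by blast
qed

text \<open>
  The property that links fibrations and generalized coverings. The assumption \<open>lift_small\<close> is
  continuity of \<open>lift\<close> at the constant path for the topology of uniform convergence; by \<open>lift_add\<close>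
  below, it gives continuity everywhere.
\<close>

locale small_path_lifting =
  fixes p :: "'h::topological_group_add \<Rightarrow> 'g::topological_group_add"
    and lift :: "(real \<Rightarrow> 'g) \<Rightarrow> real \<Rightarrow> 'h"
  assumes add: "p (a + b) = p a + p b"
    and continuous: "continuous_on UNIV p"
    and unique_paths: "unique_path_lifting euclidean p"
    and lift_based: "based_path \<alpha> \<Longrightarrow> based_path (lift \<alpha>)"
    and lift_lifts: "based_path \<alpha> \<Longrightarrow> t \<in> {0..1} \<Longrightarrow> p (lift \<alpha> t) = \<alpha> t"
    and lift_small: "open V \<Longrightarrow> 0 \<in> V \<Longrightarrow>
      \<exists>U. open U \<and> 0 \<in> U \<and> (\<forall>\<alpha>. based_path \<alpha> \<and> \<alpha> ` {0..1} \<subseteq> U \<longrightarrow> lift \<alpha> ` {0..1} \<subseteq> V)"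
begin

lemma zero [simp]: "p 0 = 0"
  using add[of 0 0] by (metis add_0_right add_left_cancel)

lemma unique:
  assumes "path \<beta>" "path \<gamma>" "\<beta> 0 = \<gamma> 0" "\<And>t. t \<in> {0..1} \<Longrightarrow> p (\<beta> t) = p (\<gamma> t)" "t \<in> {0..1}"
  shows "\<beta> t = \<gamma> t"
  using assms unique_paths unfolding unique_path_lifting_def pathin_euclidean_iff_path by blast

lemma lift_path [simp]: "based_path \<alpha> \<Longrightarrow> path (lift \<alpha>)"
  and lift_0 [simp]: "based_path \<alpha> \<Longrightarrow> lift \<alpha> 0 = 0"
  using lift_based by (auto simp: based_path_def)

lemma lift_unique:
  assumes "based_path \<alpha>" "path \<beta>" "\<beta> 0 = 0" "\<And>t. t \<in> {0..1} \<Longrightarrow> p (\<beta> t) = \<alpha> t" "t \<in> {0..1}"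
  shows "lift \<alpha> t = \<beta> t"
  by (rule unique) (use assms lift_lifts in auto)

lemma path_image: "path \<beta> \<Longrightarrow> path (p \<circ> \<beta>)"
  using continuous path_continuous_image continuous_on_subset by blast

text \<open>
  The sum of two lifts lifts the sum of the paths, and lifts are unique.
\<close>

lemma lift_add:
  assumes "based_path \<alpha>" "based_path \<beta>" "t \<in> {0..1}"
  shows "lift (\<lambda>t. \<alpha> t + \<beta> t) t = lift \<alpha> t + lift \<beta> t"
proof (rule lift_unique)
  show "based_path (\<lambda>t. \<alpha> t + \<beta> t)"
    using assms by (simp add: based_path_def path_group_add)
  show "path (\<lambda>t. lift \<alpha> t + lift \<beta> t)"
    using assms by (intro path_group_add) simp_all
qed (use assms in \<open>simp_all add: add lift_lifts\<close>)

text \<open>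
  The lift \<open>H' (t, y) = f y + lift (\<gamma> y) t\<close>, with \<open>\<gamma> y\<close> the path \<open>H (\<cdot>, y)\<close> translated to start at \<open>0\<close>,
  is continuous at \<open>(s, y0)\<close> because \<open>lift (\<gamma> y) = lift (\<gamma> y0) + lift (- \<gamma> y0 + \<gamma> y)\<close>, and the tube lemma
  makes the path \<open>- \<gamma> y0 + \<gamma> y\<close> small for all \<open>y\<close> near \<open>y0\<close>.
\<close>

theorem is_hurewicz_fibration: "hurewicz_fibration TYPE('w) euclidean euclidean p"
  unfolding hurewicz_fibration_def
proof (intro conjI allI impI; (elim conjE)?)
  show "continuous_map euclidean euclidean p" using continuous by simp
  fix Y :: "'w topology" and H f
  let ?I = "top_of_set {0..1::real}"
  assume H: "continuous_map (prod_topology ?I Y) euclidean H" and f: "continuous_map Y euclidean f"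
    and start: "\<forall>y\<in>topspace Y. p (f y) = H (0, y)"
  \<comment> \<open>the paths traced by \<open>H\<close>, translated to start at \<open>0\<close>\<close>
  define \<gamma> where "\<gamma> y = (\<lambda>t. - H (0, y) + H (t, y))" for y
  have \<gamma>: "based_path (\<gamma> y)" if "y \<in> topspace Y" for y
  proof -
    have "continuous_map ?I euclidean (\<lambda>t. H (t, y))"
      by (rule continuous_map_compose_pair[OF H]) (use that in simp_all)
    then have "path (\<lambda>t. H (t, y))" by (simp add: path_def)
    then show ?thesis by (simp add: based_path_def \<gamma>_def path_const_add)
  qed
  define H' where "H' = (\<lambda>(t, y). f y + lift (\<gamma> y) t)"
  have "topcontinuous_at (prod_topology ?I Y) euclidean H' (s, y0)"
    if s: "s \<in> {0..1}" and y0: "y0 \<in> topspace Y" for s y0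
    unfolding topcontinuous_at_def
  proof (intro conjI allI impI; (elim conjE)?)
    fix W assume W: "openin euclidean W" "H' (s, y0) \<in> W"
    \<comment> \<open>the summand \<open>0\<close> makes room for the lift of the small deviation path\<close>
    then have "open W" "f y0 + (lift (\<gamma> y0) s + 0) \<in> W" by (auto simp: H'_def)
    then obtain A C where A: "open A" "f y0 \<in> A" and C: "open C" "lift (\<gamma> y0) s + 0 \<in> C"
      and AC: "\<And>a c. a \<in> A \<Longrightarrow> c \<in> C \<Longrightarrow> a + c \<in> W"
      by (rule open_add_nhd) (rule that)
    from C obtain B V where B: "open B" "lift (\<gamma> y0) s \<in> B" and V: "open V" "0 \<in> V"
      and BV: "\<And>b v. b \<in> B \<Longrightarrow> v \<in> V \<Longrightarrow> b + v \<in> C"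
      by (rule open_add_nhd) (rule that)
    from lift_small[OF V] obtain U where U: "open U" "0 \<in> U"
      and small: "\<forall>\<alpha>. based_path \<alpha> \<and> \<alpha> ` {0..1} \<subseteq> U \<longrightarrow> lift \<alpha> ` {0..1} \<subseteq> V"
      by (elim exE conjE)
    \<comment> \<open>the deviation of the path of \<open>y\<close> from that of \<open>y0\<close>; it vanishes on \<open>{0..1} \<times> {y0}\<close>\<close>
    define D where "D x = - \<gamma> y0 (fst x) + \<gamma> (snd x) (fst x)" for x
    have "continuous_map (prod_topology ?I Y) euclidean D"
      unfolding D_def \<gamma>_def
      by (intro continuous_map_group_add continuous_map_group_minus continuous_map_compose_pair[OF H])
         (use y0 in \<open>simp_all add: continuous_map_fst continuous_map_snd\<close>)
    then have open_D: "openin (prod_topology ?I Y) {x \<in> topspace (prod_topology ?I Y). D x \<in> U}"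
      by (rule openin_continuous_map_preimage) (use U in simp)
    have compact: "compactin ?I {0..1}" by (simp add: compactin_subtopology)
    have sub: "{0..1} \<times> {y0} \<subseteq> {x \<in> topspace (prod_topology ?I Y). D x \<in> U}"
      using y0 U by (auto simp: D_def)
    obtain T N where "openin ?I T" and N: "openin Y N" and T: "{0..1} \<subseteq> T" and y0N: "y0 \<in> N"
      and TN: "T \<times> N \<subseteq> {x \<in> topspace (prod_topology ?I Y). D x \<in> U}"
      using tube_lemma_left[OF open_D compact y0 sub] by (elim exE conjE) (rule that)
    have DU: "- \<gamma> y0 t + \<gamma> y t \<in> U" if "t \<in> {0..1}" "y \<in> N" for t y
    proof -
      have "(t, y) \<in> T \<times> N" using T that by blast
      with TN have "D (t, y) \<in> U" by blast
      then show ?thesis by (simp add: D_def)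
    qed
    have "openin ?I {t \<in> topspace ?I. lift (\<gamma> y0) t \<in> B}"
      by (rule openin_continuous_map_preimage[where Y = euclidean])
         (use lift_path[OF \<gamma>[OF y0]] B in \<open>simp_all add: path_def\<close>)
    moreover have "openin Y {y \<in> topspace Y. f y \<in> A}"
      by (rule openin_continuous_map_preimage[OF f]) (use A in simp)
    ultimately have "openin (prod_topology ?I Y)
        ({t \<in> topspace ?I. lift (\<gamma> y0) t \<in> B} \<times> (N \<inter> {y \<in> topspace Y. f y \<in> A}))"
      using N by (simp add: openin_prod_Times_iff openin_Int)
    moreover have "H' (t, y) \<in> W" if t: "t \<in> {0..1}" "lift (\<gamma> y0) t \<in> B" and y: "y \<in> N" "f y \<in> A" for t y
    proof -
      have yY: "y \<in> topspace Y" using y N openin_subset by blast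
      define \<delta> where "\<delta> = (\<lambda>t. - \<gamma> y0 t + \<gamma> y t)"
      have \<delta>: "based_path \<delta>"
        using \<gamma>[OF y0] \<gamma>[OF yY] by (simp add: \<delta>_def based_path_def path_group_add path_group_minus)
      have "\<delta> ` {0..1} \<subseteq> U" using DU y by (simp add: image_subset_iff \<delta>_def)
      with small \<delta> have "lift \<delta> ` {0..1} \<subseteq> V" by simp
      with t have "lift \<delta> t \<in> V" by blast
      moreover have "lift (\<gamma> y) t = lift (\<gamma> y0) t + lift \<delta> t"
        using lift_add[OF \<gamma>[OF y0] \<delta> t(1)] by (simp add: \<delta>_def add.assoc[symmetric])
      ultimately show ?thesis using AC BV y t by (simp add: H'_def)
    qed
    moreover have "(s, y0) \<in> {t \<in> topspace ?I. lift (\<gamma> y0) t \<in> B} \<times> (N \<inter> {y \<in> topspace Y. f y \<in> A})"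
      using s y0 y0N A(2) B(2) by simp
    ultimately show "\<exists>U. openin (prod_topology ?I Y) U \<and> (s, y0) \<in> U \<and> (\<forall>x\<in>U. H' x \<in> W)"
      by (intro exI[of _ "{t \<in> topspace ?I. lift (\<gamma> y0) t \<in> B} \<times> (N \<inter> {y \<in> topspace Y. f y \<in> A})"])
         simp
  qed (use s y0 in auto)
  then have "continuous_map (prod_topology ?I Y) euclidean H'"
    unfolding continuous_map_eq_topcontinuous_at by auto
  moreover have "H' (0, y) = f y" if "y \<in> topspace Y" for y
    using \<gamma>[OF that] by (simp add: H'_def)
  moreover have "p (H' (t, y)) = H (t, y)" if "t \<in> {0..1}" "y \<in> topspace Y" for t y
    using lift_lifts[OF \<gamma>[OF that(2)] that(1)] start that
    by (simp add: H'_def add \<gamma>_def add.assoc[symmetric])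
  ultimately show "\<exists>H'. continuous_map (prod_topology ?I Y) euclidean H' \<and>
      (\<forall>y\<in>topspace Y. H' (0, y) = f y) \<and> (\<forall>t\<in>{0..1}. \<forall>y\<in>topspace Y. p (H' (t, y)) = H (t, y))"
    by blast
qed

text \<open>
  The homotopy is lifted in the direction of the loop parameter. The end points of the lifts then form a path
  in the kernel of \<open>p\<close>, which is constant by unique path lifting.
\<close>

lemma lift_homotopic_end:
  assumes ab: "(a, b) \<in> loop_homotopy euclidean 0"
  shows "lift a 1 = lift b 1"
proof -
  let ?I = "top_of_set {0..1::real}"
  obtain h where h: "continuous_map (prod_topology ?I ?I) euclidean h"
    and ha: "\<And>t. h (0, t) = a t" and hb: "\<And>t. h (1, t) = b t"
    and ends: "\<And>s. s \<in> {0..1} \<Longrightarrow> h (s, 0) = 0 \<and> h (s, 1) = 0"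
    using ab unfolding loop_homotopy_def homotopic_with_def by auto
  have swap: "continuous_map (prod_topology ?I ?I) euclidean (\<lambda>x. h (snd x, fst x))"
    by (rule continuous_map_compose_pair[OF h continuous_map_snd continuous_map_fst])
  have const: "continuous_map ?I euclidean (\<lambda>_. 0 :: 'h)" by simp
  have start: "p 0 = h (snd (0::real, s), fst (0::real, s))" if "s \<in> topspace ?I" for s
    using ends that by simp
  obtain H' where H': "continuous_map (prod_topology ?I ?I) euclidean H'"
    and H'0: "\<And>s. s \<in> topspace ?I \<Longrightarrow> H' (0, s) = 0"
    and pH'': "\<And>t s. t \<in> {0..1} \<Longrightarrow> s \<in> topspace ?I \<Longrightarrow> p (H' (t, s)) = h (snd (t, s), fst (t, s))"
    by (rule hurewicz_fibrationE[OF is_hurewicz_fibration swap const start]) (assumption, rule that)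
  have pH': "p (H' (t, s)) = h (s, t)" if "t \<in> {0..1}" "s \<in> {0..1}" for t s
    using pH''[of t s] that by simp
  have path_s: "path (\<lambda>s. H' (t, s))" and path_t: "path (\<lambda>s. H' (s, t))" if "t \<in> {0..1}" for t
    unfolding path_def continuous_map_iff_continuous[symmetric]
    by (rule continuous_map_compose_pair[OF H']; use that in simp)+
  have hI: "path (\<lambda>t. h (s, t))" if "s \<in> {0..1}" for s
    unfolding path_def continuous_map_iff_continuous[symmetric]
    by (rule continuous_map_compose_pair[OF h]) (use that in simp_all)
  have "based_path a" "based_path b"
    using hI[of 0] hI[of 1] ends[of 0] ends[of 1] by (simp_all add: ha hb based_path_def)
  then have "lift a 1 = H' (1, 0)" "lift b 1 = H' (1, 1)"
    using lift_unique[of a "\<lambda>t. H' (t, 0)" 1] lift_unique[of b "\<lambda>t. H' (t, 1)" 1]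
      path_t[of 0] path_t[of 1] H'0 pH' by (simp_all add: ha hb)
  moreover have "H' (1, 1) = H' (1, 0)"
    by (rule unique[of "\<lambda>s. H' (1, s)" "\<lambda>_. H' (1, 0)" 1])
       (use path_s[of 1] pH' ends in \<open>simp_all add: path_def\<close>)
  ultimately show ?thesis by simp
qed

lemma lift_path_concat:
  assumes a: "based_path a" and b: "path b" "b 0 = a 1"
  shows "lift (path_concat a b) 1 = lift a 1 + lift (\<lambda>t. - a 1 + b t) 1"
proof -
  let ?b = "\<lambda>t. - a 1 + b t"
  have b': "based_path ?b" using b by (simp add: based_path_def path_const_add)
  have "lift (path_concat a b) 1 = path_concat (lift a) (\<lambda>t. lift a 1 + lift ?b t) 1"
  proof (rule lift_unique[where \<beta> = "path_concat (lift a) (\<lambda>t. lift a 1 + lift ?b t)" and t = 1])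
    show "based_path (path_concat a b)"
      using a b pathin_path_concat[of euclidean a b] by (simp add: based_path_def pathin_euclidean_iff_path)
    show "path (path_concat (lift a) (\<lambda>t. lift a 1 + lift ?b t))"
      using pathin_path_concat[of euclidean "lift a" "\<lambda>t. lift a 1 + lift ?b t"] a b'
      by (simp add: pathin_euclidean_iff_path path_const_add)
    fix t :: real assume t: "t \<in> {0..1}"
    show "p (path_concat (lift a) (\<lambda>t. lift a 1 + lift ?b t) t) = path_concat a b t"
      using t lift_lifts[OF a, of "2 * t"] lift_lifts[OF a, of 1] lift_lifts[OF b', of "2 * t - 1"]
      by (simp add: path_concat_def add add.assoc[symmetric])
  qed (use a in simp_all)
  then show ?thesis by simp
qed


text \<open>
  Closing up \<open>a\<close> and \<open>b\<close> by the same way back, the reverse of \<open>b\<close>, gives two loops whose lifts end at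
  \<open>0\<close>; the way back contributes the same summand to both.
\<close>

lemma lift_end_eq:
  assumes f: "continuous_map Y euclidean f" "f y0 = 0"
    and loop: "\<And>a. a \<in> loops Y y0 \<Longrightarrow> lift (f \<circ> a) 1 = 0"
    and a: "pathin Y a" "a 0 = y0" and b: "pathin Y b" "b 0 = y0" "b 1 = a 1"
  shows "lift (f \<circ> a) 1 = lift (f \<circ> b) 1"
proof -
  define r where "r = (\<lambda>t. b (1 - t))"
  have r: "pathin Y r" "r 0 = a 1" "r 1 = y0"
    using b pathin_reverse[OF b(1)] by (simp_all add: r_def)
  have fr: "path (f \<circ> r)"
    using pathin_compose[OF r(1) f(1)] by (simp add: pathin_euclidean_iff_path)
  have "lift (f \<circ> c) 1 + lift (\<lambda>t. - f (a 1) + (f \<circ> r) t) 1 = 0"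
    if c: "pathin Y c" "c 0 = y0" "c 1 = a 1" for c
  proof -
    have "path_concat c r \<in> loops Y y0"
      using c r pathin_path_concat[of Y c r] by (simp add: loops_def)
    from loop[OF this] have "lift (path_concat (f \<circ> c) (f \<circ> r)) 1 = 0"
      by (simp add: comp_path_concat)
    moreover have "based_path (f \<circ> c)"
      using pathin_compose[OF c(1) f(1)] c(2) f(2)
      by (simp add: based_path_def pathin_euclidean_iff_path)
    from lift_path_concat[OF this fr] have "lift (path_concat (f \<circ> c) (f \<circ> r)) 1
        = lift (f \<circ> c) 1 + lift (\<lambda>t. - f (a 1) + (f \<circ> r) t) 1"
      using c r by simp
    ultimately show ?thesis by simp
  qed
  from this[of a] this[of b] a b show ?thesis
    by (metis add_right_cancel)
qed

text \<open>
  The lift sends \<open>y\<close> to the end point of the lift of \<open>f\<close> along a path from the base point to \<open>y\<close>. It is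
  continuous because points near \<open>y\<close> are reached from \<open>y\<close> by paths with small image under \<open>f\<close>.
\<close>

theorem has_unique_lifting_property: "unique_lifting_property TYPE('w) euclidean 0 euclidean 0 p"
  unfolding unique_lifting_property_def
proof (intro conjI allI impI; (elim conjE)?)
  show p: "continuous_map euclidean euclidean p" using continuous by simp
  fix Y :: "'w topology" and y0 and f
  assume conn: "connected_space Y" and lpc: "locally_path_connected_space Y" and y0: "y0 \<in> topspace Y"
    and f: "continuous_map Y euclidean f" "f y0 = 0"
    and "induced_map euclidean 0 f ` fundamental_group Y y0
       \<subseteq> induced_map euclidean 0 p ` fundamental_group euclidean 0"
  then have hom: "\<forall>a\<in>loops Y y0. \<exists>b\<in>loops euclidean 0. (f \<circ> a, p \<circ> b) \<in> loop_homotopy euclidean 0"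
    using induced_image_subset_iff[OF f p zero] by simp
  have based: "based_path (f \<circ> \<omega>)" if "pathin Y \<omega>" "\<omega> 0 = y0" for \<omega>
    using pathin_compose[OF that(1) f(1)] that(2) f(2)
    by (simp add: based_path_def pathin_euclidean_iff_path)
  have loop: "lift (f \<circ> a) 1 = 0" if a: "a \<in> loops Y y0" for a
  proof -
    obtain b where b: "path b" "b 0 = 0" "b 1 = 0" and ab: "(f \<circ> a, p \<circ> b) \<in> loop_homotopy euclidean 0"
      using hom a by (auto simp: loops_def pathin_euclidean_iff_path)
    have "lift (f \<circ> a) 1 = lift (p \<circ> b) 1" using ab by (rule lift_homotopic_end)
    also have "\<dots> = b 1"
      by (rule lift_unique) (use b path_image[OF b(1)] in \<open>simp_all add: based_path_def o_def\<close>)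
    finally show ?thesis using b by simp
  qed
  have "path_connected_space Y"
    using conn lpc path_connected_eq_connected_space by blast
  then have "\<exists>\<omega>. pathin Y \<omega> \<and> \<omega> 0 = y0 \<and> \<omega> 1 = y" if "y \<in> topspace Y" for y
    using path_connected_space_imp_path_component_of[OF _ y0 that] by (simp add: path_component_of_def)
  then obtain \<omega> where \<omega>: "\<And>y. y \<in> topspace Y \<Longrightarrow> pathin Y (\<omega> y) \<and> \<omega> y 0 = y0 \<and> \<omega> y 1 = y"
    by metis
  define F where "F = restrict (\<lambda>y. lift (f \<circ> \<omega> y) 1) (topspace Y)"
  have F_end: "F (a 1) = lift (f \<circ> a) 1" if a: "pathin Y a" "a 0 = y0" for a
  proof -
    have "a 1 \<in> topspace Y" using a(1) by (rule path_finish_in_topspace)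
    with \<omega>[OF this] lift_end_eq[OF f loop _ _ a] show ?thesis by (simp add: F_def)
  qed
  have pF: "p (F y) = f y" if "y \<in> topspace Y" for y
    using \<omega>[OF that] lift_lifts[OF based, of "\<omega> y" 1] that by (simp add: F_def)
  have F0: "F y0 = 0" using F_end[of "\<lambda>_. y0"] loop[of "\<lambda>_. y0"] y0 by (simp add: loops_def)
  have "topcontinuous_at Y euclidean F y" if y: "y \<in> topspace Y" for y
    unfolding topcontinuous_at_def
  proof (intro conjI allI impI; (elim conjE)?)
    fix W assume "openin euclidean W" "F y \<in> W"
    then have "open W" "F y + 0 \<in> W" by auto
    then obtain A V where A: "F y \<in> A" and V: "open V" "0 \<in> V"
      and AV: "\<And>a v. a \<in> A \<Longrightarrow> v \<in> V \<Longrightarrow> a + v \<in> W"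
      by (rule open_add_nhd) (rule that)
    from lift_small[OF V] obtain U where U: "open U" "0 \<in> U"
      and small: "\<forall>\<alpha>. based_path \<alpha> \<and> \<alpha> ` {0..1} \<subseteq> U \<longrightarrow> lift \<alpha> ` {0..1} \<subseteq> V"
      by (elim exE conjE)
    have "continuous_map Y euclidean (\<lambda>z. - f y + f z)"
      by (intro continuous_map_group_add f) simp
    then have "openin Y {z \<in> topspace Y. - f y + f z \<in> U}"
      by (rule openin_continuous_map_preimage) (use U in simp)
    moreover have "y \<in> {z \<in> topspace Y. - f y + f z \<in> U}" using y U by simp
    ultimately obtain N where N: "openin Y N" "path_connectedin Y N" "y \<in> N"
      and NU: "N \<subseteq> {z \<in> topspace Y. - f y + f z \<in> U}"
      using lpc unfolding locally_path_connected_space by meson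
    have "F z \<in> W" if z: "z \<in> N" for z
    proof -
      obtain \<sigma> where \<sigma>: "pathin Y \<sigma>" "\<sigma> ` {0..1} \<subseteq> N" "\<sigma> 0 = y" "\<sigma> 1 = z"
        using N z unfolding path_connectedin by (metis image_subset_iff_funcset)
      let ?\<delta> = "\<lambda>t. - f y + (f \<circ> \<sigma>) t"
      have f\<sigma>: "path (f \<circ> \<sigma>)"
        using pathin_compose[OF \<sigma>(1) f(1)] by (simp add: pathin_euclidean_iff_path)
      have "based_path ?\<delta>" using path_const_add[OF f\<sigma>, of "- f y"] \<sigma>(3) by (simp add: based_path_def)
      moreover have "?\<delta> ` {0..1} \<subseteq> U" using \<sigma>(2) NU by auto
      ultimately have "lift ?\<delta> ` {0..1} \<subseteq> V" using small by simp
      then have "lift ?\<delta> 1 \<in> V" by force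
      moreover have "F z = F y + lift ?\<delta> 1"
      proof -
        have "pathin Y (path_concat (\<omega> y) \<sigma>)" using \<omega>[OF y] \<sigma> by (intro pathin_path_concat) simp_all
        from F_end[OF this] have "F z = lift (path_concat (f \<circ> \<omega> y) (f \<circ> \<sigma>)) 1"
          using \<omega>[OF y] \<sigma> by (simp add: comp_path_concat)
        also have "\<dots> = lift (f \<circ> \<omega> y) 1 + lift ?\<delta> 1"
          using lift_path_concat[OF based f\<sigma>, of "\<omega> y"] \<omega>[OF y] \<sigma> by simp
        finally show ?thesis using y by (simp add: F_def)
      qed
      ultimately show ?thesis using A AV by simp
    qed
    then show "\<exists>U. openin Y U \<and> y \<in> U \<and> (\<forall>z\<in>U. F z \<in> W)" using N by blast
  qed (use y in auto)
  then have F: "continuous_map Y euclidean F" unfolding continuous_map_eq_topcontinuous_at by blast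
  show "\<exists>!f'. f' \<in> extensional (topspace Y) \<and> continuous_map Y euclidean f' \<and> f' y0 = 0 \<and>
      (\<forall>z\<in>topspace Y. p (f' z) = f z)"
  proof (rule ex1I)
    show "F \<in> extensional (topspace Y) \<and> continuous_map Y euclidean F \<and> F y0 = 0 \<and>
        (\<forall>z\<in>topspace Y. p (F z) = f z)"
      using F F0 pF by (simp add: F_def)
    fix f' assume f': "f' \<in> extensional (topspace Y) \<and> continuous_map Y euclidean f' \<and> f' y0 = 0 \<and>
        (\<forall>z\<in>topspace Y. p (f' z) = f z)"
    show "f' = F"
    proof (rule extensionalityI[where A = "topspace Y"])
      fix y assume y: "y \<in> topspace Y"
      have \<omega>Y: "\<omega> y t \<in> topspace Y" if "t \<in> {0..1}" for t
        using path_image_subset_topspace[of Y "\<omega> y"] \<omega>[OF y] that by blast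
      have "lift (f \<circ> \<omega> y) 1 = (f' \<circ> \<omega> y) 1"
      proof (rule lift_unique[where \<beta> = "f' \<circ> \<omega> y"])
        show "path (f' \<circ> \<omega> y)"
          using pathin_compose[of Y "\<omega> y" euclidean f'] \<omega>[OF y] f' by (simp add: pathin_euclidean_iff_path)
      qed (use \<omega>[OF y] \<omega>Y f' based in auto)
      then show "f' y = F y" using \<omega>[OF y] y by (simp add: F_def)
    qed (use f' in \<open>auto simp: F_def\<close>)
  qed
qed auto

end

section \<open>Lifting the evaluation map of the fan of small paths\<close>

text \<open>
  The neighbourhood filter of the constant path \<open>0\<close> in the space of paths starting at \<open>0\<close>, for the
  topology of uniform convergence.
\<close>

definition small_paths :: "(real \<Rightarrow> 'a::{topological_space, zero}) filter" where
  "small_paths = (INF U\<in>{U. open U \<and> 0 \<in> U}. principal {\<alpha>. based_path \<alpha> \<and> \<alpha> ` {0..1} \<subseteq> U})"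

lemma eventually_small_paths:
  "eventually P small_paths \<longleftrightarrow>
     (\<exists>U. open U \<and> 0 \<in> U \<and> (\<forall>\<alpha>. based_path \<alpha> \<and> \<alpha> ` {0..1} \<subseteq> U \<longrightarrow> P \<alpha>))"
  unfolding small_paths_def
proof (subst eventually_INF_base)
  show "\<exists>W\<in>{U. open U \<and> 0 \<in> U}. principal {\<alpha>. based_path \<alpha> \<and> \<alpha> ` {0..1} \<subseteq> W}
      \<le> inf (principal {\<alpha>. based_path \<alpha> \<and> \<alpha> ` {0..1} \<subseteq> U}) (principal {\<alpha>. based_path \<alpha> \<and> \<alpha> ` {0..1} \<subseteq> V})"
    if "U \<in> {U. open U \<and> 0 \<in> U}" "V \<in> {U. open U \<and> 0 \<in> U}" for U V :: "'a set"
    using that by (intro bexI[of _ "U \<inter> V"]) auto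
qed (auto simp: eventually_principal)

text \<open>
  The spokes are indexed by all functions \<open>real \<Rightarrow> 'a\<close>. On the spokes that do not belong to a path
  starting at \<open>0\<close> the value \<open>0\<close> keeps the map continuous; the filter \<open>small_paths\<close> ignores these
  spokes.
\<close>

definition fan_eval :: "'u + real \<times> (real \<Rightarrow> 'a) \<Rightarrow> 'a::{topological_space, zero}" where
  "fan_eval z = (case z of Inl u \<Rightarrow> 0 | Inr (t, \<alpha>) \<Rightarrow> if based_path \<alpha> then \<alpha> t else 0)"

lemma fan_eval_point: "fan_eval (fan_point t \<alpha>) = (if based_path \<alpha> then \<alpha> t else 0)"
  by (auto simp: fan_eval_def fan_point_def based_path_def)

lemma fan_eval_apex [simp]: "fan_eval fan_apex = 0"
  by (simp add: fan_eval_def fan_apex_def based_path_def)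

lemma continuous_map_fan_eval: "continuous_map (fan small_paths) euclidean fan_eval"
proof (rule continuous_map_fanI)
  show "pathin euclidean (\<lambda>t. fan_eval (fan_point t \<alpha>))" for \<alpha> :: "real \<Rightarrow> 'b"
  proof (cases "based_path \<alpha>")
    case True
    then show ?thesis by (simp add: fan_eval_point pathin_euclidean_iff_path) (simp add: based_path_def)
  qed (simp add: fan_eval_point)
  fix W :: "'b set" assume "openin euclidean W" "fan_eval fan_apex \<in> W"
  then show "\<forall>\<^sub>F \<alpha> in small_paths. \<forall>t\<in>{0..1}. fan_eval (fan_point t \<alpha>) \<in> W"
    unfolding eventually_small_paths by (intro exI[of _ W]) (auto simp: fan_eval_point)
qed

text \<open>
  A lift of the evaluation map restricts on the spoke of \<open>\<alpha>\<close> to a lift of \<open>\<alpha>\<close>, and its continuity at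
  the apex is precisely the smallness of the lifts of small paths.
\<close>

lemma small_path_lifting_of_fan_lift:
  fixes p :: "'h::topological_group_add \<Rightarrow> 'g::topological_group_add"
    and F :: "'u + real \<times> (real \<Rightarrow> 'g) \<Rightarrow> 'h"
  assumes "\<And>a b. p (a + b) = p a + p b" "continuous_on UNIV p" "unique_path_lifting euclidean p"
    and F: "continuous_map (fan small_paths) euclidean F" "F fan_apex = 0"
    and lift: "\<And>z. z \<in> topspace (fan small_paths) \<Longrightarrow> p (F z) = fan_eval z"
  shows "small_path_lifting p (\<lambda>\<alpha> t. F (fan_point t \<alpha>))"
proof
  fix \<alpha> :: "real \<Rightarrow> 'g" assume \<alpha>: "based_path \<alpha>"
  have "pathin euclidean (F \<circ> (\<lambda>t. fan_point t \<alpha>))"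
    by (rule pathin_compose[OF pathin_fan_point F(1)])
  then show "based_path (\<lambda>t. F (fan_point t \<alpha>))"
    using F(2) by (simp add: based_path_def pathin_euclidean_iff_path o_def)
  show "p (F (fan_point t \<alpha>)) = \<alpha> t" if "t \<in> {0..1}" for t
    using lift[OF fan_point_in_topspace[OF that]] \<alpha> by (simp add: fan_eval_point)
next
  fix V :: "'h set" assume "open V" "0 \<in> V"
  then have "\<forall>\<^sub>F \<alpha> in small_paths. \<forall>t\<in>{0..1}. F (fan_point t \<alpha>) \<in> V"
    using eventually_fan_spoke[OF F(1), of V] F(2) by simp
  then show "\<exists>U. open U \<and> 0 \<in> U \<and>
      (\<forall>\<alpha>. based_path \<alpha> \<and> \<alpha> ` {0..1} \<subseteq> U \<longrightarrow> (\<lambda>t. F (fan_point t \<alpha>)) ` {0..1} \<subseteq> V)"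
    by (simp add: eventually_small_paths image_subset_iff)
qed (use assms in auto)

text \<open>
  Composition with the radial contraction turns the evaluation map into a homotopy from the constant map
  \<open>0\<close>, which lifts to the constant map \<open>0\<close>, to the evaluation map. At the final time, the lifted
  homotopy is a lift of the evaluation map; it stays at \<open>0\<close> over the apex by unique path lifting.
\<close>

lemma small_path_lifting_of_rigid_covering_fibration:
  fixes p :: "'h::topological_group_add \<Rightarrow> 'g::topological_group_add"
  assumes add: "\<And>a b. p (a + b) = p a + p b"
    and rigid: "rigid_covering_fibration TYPE(('v, 'g) test_points) euclidean euclidean p"
  shows "\<exists>lift. small_path_lifting p lift"
proof -
  let ?I = "top_of_set {0..1::real}"
  let ?Y = "fan small_paths :: ('v, 'g) test_points topology"
  have p0: "p 0 = 0" using add[of 0 0] by (metis add_0_right add_left_cancel)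
  have hf: "hurewicz_fibration TYPE(('v, 'g) test_points) euclidean euclidean p"
    and upl: "unique_path_lifting euclidean p"
    using rigid by (simp_all add: rigid_covering_fibration_def)
  have p: "continuous_on UNIV p" using hf by (simp add: hurewicz_fibration_def)
  let ?H = "\<lambda>x. fan_eval (case x of (s, z) \<Rightarrow> fan_scale s z)"
  have H: "continuous_map (prod_topology ?I ?Y) euclidean ?H"
    using continuous_map_compose[OF continuous_map_fan_scale continuous_map_fan_eval]
    unfolding o_def .
  have scale_0: "fan_scale 0 z = fan_apex" and scale_1: "fan_scale 1 z = z" if "z \<in> topspace ?Y" for z
    using that by (auto simp: topspace_fan)
  have const: "continuous_map ?Y euclidean (\<lambda>_. 0 :: 'h)" by simp
  have start: "p 0 = ?H (0, z)" if "z \<in> topspace ?Y" for z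
    using scale_0[OF that] p0 by simp
  obtain H' where H': "continuous_map (prod_topology ?I ?Y) euclidean H'"
    and H'0: "\<And>z. z \<in> topspace ?Y \<Longrightarrow> H' (0, z) = 0"
    and pH': "\<And>s z. s \<in> {0..1} \<Longrightarrow> z \<in> topspace ?Y \<Longrightarrow> p (H' (s, z)) = ?H (s, z)"
    by (rule hurewicz_fibrationE[OF hf H const start]) (assumption, rule that)
  have "small_path_lifting p (\<lambda>\<alpha> t. H' (1, fan_point t \<alpha>))"
  proof (rule small_path_lifting_of_fan_lift[OF add p upl])
    show "continuous_map ?Y euclidean (\<lambda>z. H' (1, z))"
      by (rule continuous_map_compose_pair[OF H']) simp_all
    show "p (H' (1, z)) = fan_eval z" if "z \<in> topspace ?Y" for z
      using pH'[OF _ that, of 1] scale_1[OF that] by simp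
    have "pathin euclidean (\<lambda>s. H' (s, fan_apex))"
      unfolding pathin_def by (rule continuous_map_compose_pair[OF H']) simp_all
    moreover have "pathin euclidean (\<lambda>_::real. 0 :: 'h)" by simp
    moreover have "\<forall>s\<in>{0..1}. p (H' (s, fan_apex)) = p 0" using pH' p0 by simp
    ultimately show "H' (1, fan_apex) = 0"
      using upl[unfolded unique_path_lifting_def, rule_format, of "\<lambda>s. H' (s, fan_apex)" "\<lambda>_. 0" 1] H'0
      by simp
  qed
  then show ?thesis by blast
qed

text \<open>
  The difference \<open>\<kappa>\<close> of two paths with the same start and the same projection is a path in the kernel
  of \<open>p\<close> starting at \<open>0\<close>. Running through \<open>\<kappa>\<close> on every spoke of the fan is then a lift of the constant
  map \<open>0\<close>, as is the constant map \<open>0\<close>. The fan over \<open>bot\<close> is used since there the apex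
  imposes no uniformity on the spokes, so that the former lift is continuous.
\<close>

lemma unique_path_lifting_of_generalized_covering_group:
  fixes p :: "'h::topological_group_add \<Rightarrow> 'g::topological_group_add"
  assumes cov: "generalized_covering_group TYPE('u + real \<times> 'i) p"
  shows "unique_path_lifting euclidean p"
  unfolding unique_path_lifting_def
proof (intro allI impI ballI, elim conjE)
  fix \<alpha> \<beta> :: "real \<Rightarrow> 'h" and t :: real
  assume \<alpha>: "pathin euclidean \<alpha>" and \<beta>: "pathin euclidean \<beta>"
    and eq: "\<forall>t\<in>{0..1}. p (\<alpha> t) = p (\<beta> t)" and start: "\<alpha> 0 = \<beta> 0" and t: "t \<in> {0..1}"
  let ?Y = "fan bot :: ('u + real \<times> 'i) topology"
  have add: "p (a + b) = p a + p b" for a b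
    using cov by (simp add: generalized_covering_group_def)
  have ulp: "unique_lifting_property TYPE('u + real \<times> 'i) euclidean 0 euclidean 0 p"
    using cov by (simp add: generalized_covering_group_def generalized_covering_map_def)
  have p0: "p 0 = 0" using add[of 0 0] by (metis add_0_right add_left_cancel)
  define \<kappa> where "\<kappa> = (\<lambda>t. - \<alpha> t + \<beta> t)"
  have \<kappa>: "pathin euclidean \<kappa>"
    using \<alpha> \<beta> by (simp add: \<kappa>_def pathin_euclidean_iff_path path_group_add path_group_minus)
  have p\<kappa>: "p (\<kappa> t) = 0" if "t \<in> {0..1}" for t
  proof -
    have "p (\<beta> t) + p (\<kappa> t) = p (\<beta> t)"
      using eq that by (metis \<kappa>_def add add.assoc add.right_inverse add_0_left)
    then show ?thesis by (metis add_0_right add_left_cancel)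
  qed
  have "\<exists>!f'. f' \<in> extensional (topspace ?Y) \<and> continuous_map ?Y euclidean f' \<and>
      f' fan_apex = 0 \<and> (\<forall>z\<in>topspace ?Y. p (f' z) = 0)"
    by (rule unique_lift_of_fan[OF ulp]) simp_all
  moreover
  define f where "f = restrict (\<lambda>_. 0 :: 'h) (topspace ?Y)"
  have "f \<in> extensional (topspace ?Y) \<and> continuous_map ?Y euclidean f \<and>
      f fan_apex = 0 \<and> (\<forall>z\<in>topspace ?Y. p (f z) = 0)"
    using p0 by (simp add: f_def)
  moreover
  define g where "g = restrict (\<lambda>z. \<kappa> (case z of Inr (t, i) \<Rightarrow> t)) (topspace ?Y)"
  have g: "g (fan_point t i) = \<kappa> t" if "t \<in> {0..1}" for t i
    using that by (simp add: g_def) (simp add: fan_point_def)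
  have "continuous_map ?Y euclidean g"
  proof (rule continuous_map_fanI)
    show "pathin euclidean (\<lambda>t. g (fan_point t i))" for i
      using \<kappa> unfolding pathin_def by (rule continuous_map_eq) (simp add: g)
  qed simp
  then have "g \<in> extensional (topspace ?Y) \<and> continuous_map ?Y euclidean g \<and>
      g fan_apex = 0 \<and> (\<forall>z\<in>topspace ?Y. p (g z) = 0)"
  proof (intro conjI ballI)
    show "g \<in> extensional (topspace ?Y)" by (simp add: g_def)
    show "g fan_apex = 0" using g[of 0] start by (simp add: \<kappa>_def)
    show "p (g z) = 0" if "z \<in> topspace ?Y" for z
      using that p\<kappa> g by (auto elim: topspace_fanE)
  qed
  ultimately have "g (fan_point t undefined) = f (fan_point t undefined)" by metis
  moreover have "f (fan_point t undefined) = 0" using t by (simp add: f_def)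
  ultimately have "\<kappa> t = 0" using g[OF t, of undefined] by simp
  then show "\<alpha> t = \<beta> t" using minus_unique[of "- \<alpha> t" "\<beta> t"] by (simp add: \<kappa>_def)
qed

text \<open>
  The evaluation map of the fan satisfies the hypothesis of the lifting criterion, because all loops in
  the fan at the apex are null-homotopic.
\<close>

lemma small_path_lifting_of_generalized_covering_group:
  fixes p :: "'h::topological_group_add \<Rightarrow> 'g::topological_group_add"
  assumes cov: "generalized_covering_group TYPE(('u, 'g) test_points) p"
  shows "\<exists>lift. small_path_lifting p lift"
proof -
  have add: "p (a + b) = p a + p b" for a b
    using cov by (simp add: generalized_covering_group_def)
  have ulp: "unique_lifting_property TYPE(('u, 'g) test_points) euclidean 0 euclidean 0 p"
    using cov by (simp add: generalized_covering_group_def generalized_covering_map_def)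
  then have p: "continuous_on UNIV p" by (simp add: unique_lifting_property_def)
  obtain F :: "('u, 'g) test_points \<Rightarrow> 'h" where "continuous_map (fan small_paths) euclidean F"
    "F fan_apex = 0" "\<forall>z\<in>topspace (fan small_paths). p (F z) = fan_eval z"
    using unique_lift_of_fan[OF ulp continuous_map_fan_eval fan_eval_apex] by (elim ex1E conjE)
  then have "small_path_lifting p (\<lambda>\<alpha> t. F (fan_point t \<alpha>))"
    using unique_path_lifting_of_generalized_covering_group[OF cov]
    by (intro small_path_lifting_of_fan_lift[OF add p]) simp_all
  then show ?thesis by blast
qed

theorem proposition3p12:
  fixes p :: "'h::topological_group_add \<Rightarrow> 'g::topological_group_add"
  assumes "connected_space (euclidean :: 'g topology)"
    and "locally_path_connected_space (euclidean :: 'g topology)"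
    and "connected_space (euclidean :: 'h topology)"
    and "locally_path_connected_space (euclidean :: 'h topology)"
    and "continuous_map euclidean euclidean p"
    and "\<And>a b. p (a + b) = p a + p b"
  shows "generalized_covering_group TYPE(('u, 'g) test_points) p \<longleftrightarrow>
         rigid_covering_fibration TYPE(('v, 'g) test_points) euclidean euclidean p"
proof
  assume "generalized_covering_group TYPE(('u, 'g) test_points) p"
  then obtain lift where "small_path_lifting p lift"
    using small_path_lifting_of_generalized_covering_group by blast
  then interpret small_path_lifting p lift .
  show "rigid_covering_fibration TYPE(('v, 'g) test_points) euclidean euclidean p"
    unfolding rigid_covering_fibration_def using is_hurewicz_fibration unique_paths by blast
next
  assume "rigid_covering_fibration TYPE(('v, 'g) test_points) euclidean euclidean p"
  then obtain lift where "small_path_lifting p lift"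
    using small_path_lifting_of_rigid_covering_fibration[OF assms(6)] by blast
  then interpret small_path_lifting p lift .
  show "generalized_covering_group TYPE(('u, 'g) test_points) p"
    unfolding generalized_covering_group_def generalized_covering_map_def
    using has_unique_lifting_property assms(3,4,6) by blast
qed

end
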